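(* Let $\Omega$ be a commutative semigroup with unit, let $(V;\rho,\theta)$ be a representation of a Lie-Yamaguti algebra $(L,[\cdot,\cdot],\{\cdot,\cdot,\cdot\})$, let $\Gamma=(\Gamma_1,\Gamma_2)$ be a $(2,3)$-cocycle of $L$ with coefficients in $V$, and let $T=\{T_\alpha:V\to L\}_{\alpha\in\Omega}$ be a $\Gamma$-twisted Rota-Baxter family. Let $T^t=T+tT^1$ and $\overline T^t=T+t\overline T^1$ be two equivalent linear deformations of $T$. Then their infinitesimals $T^1$ and $\overline T^1$ are in the same cohomology class, i.e. $T^1$ and $\overline T^1$ are $1$-cocycles defining the same element of $H^1_{\Omega\text{-}\mathrm{LY}}(V,L)$.
   Context: All vector spaces are over an algebraically closed field $\mathbb K$ of characteristic different from $2$ and $3$. **Lie-Yamaguti algebra.** A vector space $L$ with a bilinear bracket $[\cdot,\cdot]:\wedge^2L\to L$ and a trilinear bracket $\{\cdot,\cdot,\cdot\}:\wedge^2L\otimes L\to L$ (skew-symmetric in the first two arguments) such that for all $x,y,z,a,b\in L$: (1) $[[x,y],z]+[[y,z],x]+[[z,x],y]+\{x,y,z\}+\{z,x,y\}+\{y,z,x\}=0$; (2) $\{[x,y],z,a\}+\{[y,z],x,a\}+\{[z,x],y,a\}=0$; (3) $\{a,b,[x,y]\}=[\{a,b,x\},y]+[x,\{a,b,y\}]$; (4) $\{a,b,\{x,y,z\}\}=\{\{a,b,x\},y,z\}+\{x,\{a,b,y\},z\}+\{x,y,\{a,b,z\}\}$. **Representation.** A representation of $L$ on a vector space $V$ is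 a linear map $\rho:L\to\mathrm{End}(V)$ and a bilinear map $\theta:L\times L\to\mathrm{End}(V)$ such that, with $D(x,y)=\theta(y,x)-\theta(x,y)-\rho([x,y])+\rho(x)\rho(y)-\rho(y)\rho(x)$, for all $x,y,z,a,b\in L$: $\theta([x,y],z)-\theta(x,z)\rho(y)+\theta(y,z)\rho(x)=0$; $D(x,y)\rho(z)-\rho(z)D(x,y)-\rho(\{x,y,z\})=0$; $\theta(x,[y,z])-\rho(y)\theta(x,z)+\rho(z)\theta(x,y)=0$; $D(a,b)\theta(x,y)-\theta(x,y)D(a,b)-\theta(\{a,b,x\},y)-\theta(x,\{a,b,y\})=0$; $\theta(a,\{x,y,z\})-\theta(y,z)\theta(a,x)+\theta(x,z)\theta(a,y)-D(x,y)\theta(a,z)=0$. **$(2,3)$-cocycle.** A pair $\Gamma=(\Gamma_1,\Gamma_2)\in\mathrm{Hom}(\wedge^2L,V)\times\mathrm{Hom}(\wedge^2L\otimes L,V)$ such that for all $x_1,y_1,x_2,y_2,z\in L$: $-\rho(x_1)\Gamma_1(y_1,z)-\rho(y_1)\Gamma_1(z,x_1)-\rho(z)\Gamma_1(x_1,y_1)+\Gamma_1([x_1,y_1],z)+\Gamma_1([y_1,z],x_1)+\Gamma_1([z,x_1],y_1)+\Gamma_2(x_1,y_1,z)+\Gamma_2(y_1,z,x_1)+\Gamma_2(z,x_1,y_1)=0$; $\theta(x_1,y_2)\Gamma_1(y_1,x_2)+\theta(y_1,y_2)\Gamma_1(x_2,x_1)+\theta(x_2,y_2)\Gamma_1(x_1,y_1)+\Gamma_2([x_1,y_1],x_2,y_2)+\Gamma_2([y_1,x_2],x_1,y_2)+\Gamma_2([x_2,x_1],y_1,y_2)=0$;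 $-\rho(x_2)\Gamma_2(x_1,y_1,y_2)+\rho(y_2)\Gamma_2(x_1,y_1,x_2)+\Gamma_2(x_1,y_1,[x_2,y_2])+D(x_1,y_1)\Gamma_1(x_2,y_2)-\Gamma_1(\{x_1,y_1,x_2\},y_2)-\Gamma_1(x_2,\{x_1,y_1,y_2\})=0$; $-\theta(y_2,z)\Gamma_2(x_1,y_1,x_2)+\theta(x_2,z)\Gamma_2(x_1,y_1,y_2)+D(x_1,y_1)\Gamma_2(x_2,y_2,z)-D(x_2,y_2)\Gamma_2(x_1,y_1,z)-\Gamma_2(\{x_1,y_1,x_2\},y_2,z)-\Gamma_2(x_2,\{x_1,y_1,y_2\},z)+\Gamma_2(x_1,y_1,\{x_2,y_2,z\})-\Gamma_2(x_2,y_2,\{x_1,y_1,z\})=0$. **$\Gamma$-twisted Rota-Baxter family.** A collection of linear maps $\{T_\alpha:V\to L\}_{\alpha\in\Omega}$ such that for all $u,v,w\in V$, $\alpha,\beta,\gamma\in\Omega$: $[T_\alpha u,T_\beta v]=T_{\alpha\beta}\big(\rho(T_\alpha u)v-\rho(T_\beta v)u+\Gamma_1(T_\alpha u,T_\beta v)\big)$; $\{T_\alpha u,T_\beta v,T_\gamma w\}=T_{\alpha\beta\gamma}\big(D(T_\alpha u,T_\beta v)w-\theta(T_\alpha u,T_\gamma w)v+\theta(T_\beta v,T_\gamma w)u+\Gamma_2(T_\alpha u,T_\beta v,T_\gamma w)\big)$. **Low-degree cohomology of $T$.** $C^0=\wedge^2L$. $C^1$ is the space of collections $f=\{f_\alpha:V\to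 L\}_{\alpha\in\Omega}$ of linear maps. Elements of $\wedge^2 L$ are written $(a,b)$ and all expressions below in $(a,b)$ are skew-symmetric bilinear in $a,b$ and extended linearly to $\wedge^2L$. Define $\partial_\Omega:C^0\to C^1$ by $(\partial_\Omega(a,b))_\alpha u=T_\alpha\big(D(a,b)u+\Gamma_2(a,b,T_\alpha u)\big)-\{a,b,T_\alpha u\}$. For $f\in C^1$ define $\partial_\Omega f=(\partial_{\mathrm I}f,\partial_{\mathrm{II}}f)$ by $(\partial_{\mathrm I}f)_{\alpha,\beta}(u,v)=[T_\alpha u,f_\beta v]+T_{\alpha\beta}\big(\rho(f_\beta v)u+\Gamma_1(f_\beta v,T_\alpha u)\big)-[T_\beta v,f_\alpha u]-T_{\alpha\beta}\big(\rho(f_\alpha u)v+\Gamma_1(f_\alpha u,T_\beta v)\big)-f_{\alpha\beta}\big(\rho(T_\alpha u)v-\rho(T_\beta v)u+\Gamma_1(T_\alpha u,T_\beta v)\big)$, $(\partial_{\mathrm{II}}f)_{\alpha,\beta,\gamma}(u,v,w)=\{T_\alpha u,T_\beta v,f_\gamma w\}-T_{\alpha\beta\gamma}\big(\theta(T_\beta v,f_\gamma w)u-\theta(T_\alpha u,f_\gamma w)v+\Gamma_2(T_\alpha u,T_\beta v,f_\gamma w)\big)+\{f_\alpha u,T_\beta v,T_\gamma w\}-T_{\alpha\beta\gamma}\big(D(f_\alpha u,T_\beta v)w-\theta(f_\alpha u,T_\gamma w)v+\Gamma_2(f_\alpha u,T_\beta v,T_\gamma w)\big)-\{f_\beta v,T_\alpha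 u,T_\gamma w\}+T_{\alpha\beta\gamma}\big(D(f_\beta v,T_\alpha u)w-\theta(f_\beta v,T_\gamma w)u+\Gamma_2(f_\beta v,T_\alpha u,T_\gamma w)\big)-f_{\alpha\beta\gamma}\big(D(T_\alpha u,T_\beta v)w+\theta(T_\beta v,T_\gamma w)u-\theta(T_\alpha u,T_\gamma w)v+\Gamma_2(T_\alpha u,T_\beta v,T_\gamma w)\big)$. A $1$-cocycle is $f\in C^1$ with $\partial_\Omega f=0$; $Z^1$ is the space of $1$-cocycles, $B^1=\partial_\Omega(C^0)\subseteq Z^1$, and $H^1_{\Omega\text{-}\mathrm{LY}}(V,L)=Z^1/B^1$. **Linear deformations.** A linear deformation of $T$ is a sum $T^t=T+tT^1$, with $T^1=\{T^1_\alpha:V\to L\}_{\alpha\in\Omega}$ a collection of linear maps, such that $\{T^t_\alpha=T_\alpha+tT^1_\alpha\}_{\alpha\in\Omega}$ is a $\Gamma$-twisted Rota-Baxter family for all $t$. $T^1$ is called its infinitesimal. Two linear deformations $T^t=T+tT^1$, $\overline T^t=T+t\overline T^1$ are equivalent if there is $(a,b)\in\wedge^2L$ such that the maps $\zeta^t_\alpha=\mathrm{id}_V+t\big(D(a,b)(\cdot)+\Gamma_2(a,b,T_\alpha(\cdot))\big):V[t]\to V[t]$ ($\alpha\in\Omega$) and $\eta^t=\mathrm{id}_L+t\{a,b,\cdot\}:L[t]\to L[t]$ satisfy $\eta^t\circ T^t_\alpha=\overline T^t_\alpha\circ\zeta^t_\alpha$ for all $\alpha\in\Omega$. *)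

theory Defs
  imports "HOL-Computational_Algebra.Computational_Algebra" "HOL-Library.Poly_Mapping"
begin

section \<open>Multilinear maps\<close>

text \<open>A vector space over a field \<open>'k\<close> is given by its scalar multiplication
  \<open>s :: 'k \<Rightarrow> 'a \<Rightarrow> 'a\<close>, as in the library locale \<open>vector_space\<close>.\<close>

definition bilinear_map ::
  "('k::field \<Rightarrow> 'a::ab_group_add \<Rightarrow> 'a) \<Rightarrow> ('k \<Rightarrow> 'b::ab_group_add \<Rightarrow> 'b) \<Rightarrow>
   ('k \<Rightarrow> 'c::ab_group_add \<Rightarrow> 'c) \<Rightarrow> ('a \<Rightarrow> 'b \<Rightarrow> 'c) \<Rightarrow> bool" where
  "bilinear_map sA sB sC f \<longleftrightarrow>
     (\<forall>x. Vector_Spaces.linear sB sC (\<lambda>y. f x y)) \<and>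
     (\<forall>y. Vector_Spaces.linear sA sC (\<lambda>x. f x y))"

definition trilinear_map ::
  "('k::field \<Rightarrow> 'a::ab_group_add \<Rightarrow> 'a) \<Rightarrow> ('k \<Rightarrow> 'b::ab_group_add \<Rightarrow> 'b) \<Rightarrow>
   ('k \<Rightarrow> 'c::ab_group_add \<Rightarrow> 'c) \<Rightarrow> ('k \<Rightarrow> 'd::ab_group_add \<Rightarrow> 'd) \<Rightarrow>
   ('a \<Rightarrow> 'b \<Rightarrow> 'c \<Rightarrow> 'd) \<Rightarrow> bool" where
  "trilinear_map sA sB sC sD f \<longleftrightarrow>
     (\<forall>x. bilinear_map sB sC sD (\<lambda>y z. f x y z)) \<and>
     (\<forall>y z. Vector_Spaces.linear sA sD (\<lambda>x. f x y z))"


section \<open>The exterior square\<close>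

text \<open>The exterior square of \<open>L\<close> is the free vector space on \<open>L \<times> L\<close> modulo the subspace spanned by
  the relations making \<open>(x, y) \<mapsto> x \<and> y\<close> bilinear and alternating; its elements are the cosets.\<close>

definition free_scale :: "'k::field \<Rightarrow> ('b \<Rightarrow>\<^sub>0 'k) \<Rightarrow> ('b \<Rightarrow>\<^sub>0 'k)" where
  "free_scale c \<xi> = Poly_Mapping.map (\<lambda>d. c * d) \<xi>"

abbreviation gen :: "'l \<Rightarrow> 'l \<Rightarrow> ('l \<times> 'l) \<Rightarrow>\<^sub>0 'k::field" where
  "gen x y \<equiv> Poly_Mapping.single (x, y) 1"

definition wedge2_relations ::
  "('k::field \<Rightarrow> 'l::ab_group_add \<Rightarrow> 'l) \<Rightarrow> (('l \<times> 'l) \<Rightarrow>\<^sub>0 'k) set" where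
  "wedge2_relations sL = module.span free_scale
     ({gen (x + y) z - gen x z - gen y z | x y z. True} \<union>
      {gen x (y + z) - gen x y - gen x z | x y z. True} \<union>
      {gen (sL c x) y - free_scale c (gen x y) | c x y. True} \<union>
      {gen x (sL c y) - free_scale c (gen x y) | c x y. True} \<union>
      {gen x x | x. True})"

definition wedge2 ::
  "('k::field \<Rightarrow> 'l::ab_group_add \<Rightarrow> 'l) \<Rightarrow> (('l \<times> 'l) \<Rightarrow>\<^sub>0 'k) set set" where
  "wedge2 sL = UNIV // {(\<xi>, \<xi>'). \<xi>' - \<xi> \<in> wedge2_relations sL}"

definition free_lift ::
  "('k::field \<Rightarrow> 'w::ab_group_add \<Rightarrow> 'w) \<Rightarrow> ('l \<Rightarrow> 'l \<Rightarrow> 'w) \<Rightarrow> (('l \<times> 'l) \<Rightarrow>\<^sub>0 'k) \<Rightarrow> 'w" where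
  "free_lift sW \<phi> \<xi> =
     (\<Sum>p\<in>Poly_Mapping.keys \<xi>. sW (Poly_Mapping.lookup \<xi> p) (\<phi> (fst p) (snd p)))"

text \<open>The linear map on the exterior square induced by an alternating bilinear map \<open>\<phi>\<close>, i.e. the
  linear extension of \<open>x \<and> y \<mapsto> \<phi> x y\<close>; see \<open>wedge2_lift_eq\<close> for independence of the
  representative.\<close>

definition wedge2_lift ::
  "('k::field \<Rightarrow> 'w::ab_group_add \<Rightarrow> 'w) \<Rightarrow> ('l \<Rightarrow> 'l \<Rightarrow> 'w) \<Rightarrow> (('l \<times> 'l) \<Rightarrow>\<^sub>0 'k) set \<Rightarrow> 'w" where
  "wedge2_lift sW \<phi> \<omega> = (THE w. \<forall>\<xi>\<in>\<omega>. free_lift sW \<phi> \<xi> = w)"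

lemma lookup_free_scale [simp]:
  "Poly_Mapping.lookup (free_scale c \<xi>) p = c * Poly_Mapping.lookup \<xi> p"
  by (simp add: free_scale_def Poly_Mapping.map.rep_eq when_def)

lemma vector_space_free_scale: "vector_space free_scale"
  by unfold_locales (auto intro!: poly_mapping_eqI simp: lookup_add algebra_simps)

lemma linear_free_lift:
  fixes sW :: "'k::field \<Rightarrow> 'w::ab_group_add \<Rightarrow> 'w" and \<phi> :: "'l \<Rightarrow> 'l \<Rightarrow> 'w"
  assumes "vector_space sW"
  shows "Vector_Spaces.linear free_scale sW (free_lift sW \<phi>)"
proof -
  interpret W: vector_space sW by fact
  interpret F: vector_space free_scale by (rule vector_space_free_scale)
  have sup: "free_lift sW \<phi> \<xi> = (\<Sum>p\<in>S. sW (Poly_Mapping.lookup \<xi> p) (\<phi> (fst p) (snd p)))"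
    if "finite S" "Poly_Mapping.keys \<xi> \<subseteq> S" for S \<xi>
    unfolding free_lift_def using that
    by (intro sum.mono_neutral_left) (auto simp: in_keys_iff)
  show ?thesis
  proof unfold_locales
    fix \<xi> \<xi>' :: "('l \<times> 'l) \<Rightarrow>\<^sub>0 'k" and c :: 'k
    let ?S = "Poly_Mapping.keys \<xi> \<union> Poly_Mapping.keys \<xi>'"
    have k: "Poly_Mapping.keys (\<xi> + \<xi>') \<subseteq> ?S"
      by (rule Poly_Mapping.keys_add)
    show "free_lift sW \<phi> (\<xi> + \<xi>') = free_lift sW \<phi> \<xi> + free_lift sW \<phi> \<xi>'"
      using k by (simp add: sup[of ?S] lookup_add W.scale_left_distrib sum.distrib)
    have "Poly_Mapping.keys (free_scale c \<xi>) \<subseteq> Poly_Mapping.keys \<xi>"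
      by (auto simp: in_keys_iff)
    then show "free_lift sW \<phi> (free_scale c \<xi>) = sW c (free_lift sW \<phi> \<xi>)"
      by (simp add: sup[of "Poly_Mapping.keys \<xi>"] W.scale_sum_right)
  qed
qed

lemma free_lift_gen:
  assumes "vector_space sW"
  shows "free_lift sW \<phi> (gen x y) = \<phi> x y"
proof -
  interpret W: vector_space sW by fact
  show ?thesis by (simp add: free_lift_def)
qed

lemma wedge2_lift_eq:
  assumes bil: "bilinear_map sL sL sW \<phi>" and alt: "\<And>x. \<phi> x x = 0"
  assumes \<omega>: "\<omega> \<in> wedge2 sL" and \<xi>: "\<xi> \<in> \<omega>"
  shows "wedge2_lift sW \<phi> \<omega> = free_lift sW \<phi> \<xi>"
proof -
  have l1: "Vector_Spaces.linear sL sW (\<lambda>x. \<phi> x y)"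
    and l2: "Vector_Spaces.linear sL sW (\<phi> x)" for x y
    using bil by (auto simp: bilinear_map_def)
  interpret W: vector_space sW
    using l1 by (rule Vector_Spaces.linear.axioms(2))
  interpret F: vector_space free_scale by (rule vector_space_free_scale)
  interpret f: Vector_Spaces.linear free_scale sW "free_lift sW \<phi>"
    by (rule linear_free_lift) unfold_locales
  note g = free_lift_gen[OF W.vector_space_axioms, of \<phi>]
  note a1 = module_hom.add[OF Vector_Spaces.linear.axioms(3)[OF l1]] module_hom.add[OF Vector_Spaces.linear.axioms(3)[OF l2]]
    module_hom.scale[OF Vector_Spaces.linear.axioms(3)[OF l1]] module_hom.scale[OF Vector_Spaces.linear.axioms(3)[OF l2]]
  have rel: "free_lift sW \<phi> r = 0" if "r \<in> wedge2_relations sL" for r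
    using that unfolding wedge2_relations_def
  proof (induction rule: F.span_induct)
    case base
    show ?case
      unfolding F.subspace_def by (simp add: f.add f.scale f.zero)
  next
    case (step x)
    then show ?case
      by (elim UnE CollectE exE conjE) (simp_all only: f.diff f.scale g a1 alt, simp_all)
  qed
  have same: "free_lift sW \<phi> \<xi>' = free_lift sW \<phi> \<xi>''" if "\<xi>' \<in> \<omega>" "\<xi>'' \<in> \<omega>" for \<xi>' \<xi>''
  proof -
    obtain \<xi>\<^sub>0 where "\<omega> = {\<xi>. \<xi> - \<xi>\<^sub>0 \<in> wedge2_relations sL}"
      using \<omega> unfolding wedge2_def by (elim quotientE) auto
    with that have "free_lift sW \<phi> (\<xi>' - \<xi>\<^sub>0) = 0" "free_lift sW \<phi> (\<xi>'' - \<xi>\<^sub>0) = 0"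
      using rel by auto
    then show ?thesis by (simp add: f.diff)
  qed
  show ?thesis
    unfolding wedge2_lift_def
  proof (rule the_equality)
    show "\<forall>\<xi>'\<in>\<omega>. free_lift sW \<phi> \<xi>' = free_lift sW \<phi> \<xi>"
      by (intro ballI same \<xi>)
    show "w = free_lift sW \<phi> \<xi>" if "\<forall>\<xi>\<in>\<omega>. free_lift sW \<phi> \<xi> = w" for w
      using bspec[OF that \<xi>] by (rule sym)
  qed
qed


section \<open>Lie-Yamaguti algebras and representations\<close>

text \<open>Throughout, skew-symmetry is equivalent to being alternating once the characteristic is
  different from \<open>2\<close>, so that \<open>Hom(\<Lambda>\<^sup>2L, V)\<close> is the space of skew-symmetric bilinear maps.\<close>

locale lie_yamaguti_algebra =
  L: vector_space sL
  for sL :: "'k::field \<Rightarrow> 'l::ab_group_add \<Rightarrow> 'l" +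
  fixes br :: "'l \<Rightarrow> 'l \<Rightarrow> 'l" and tr :: "'l \<Rightarrow> 'l \<Rightarrow> 'l \<Rightarrow> 'l"
  assumes br_bilinear: "bilinear_map sL sL sL br"
    and br_skew: "br x y = - br y x"
    and tr_trilinear: "trilinear_map sL sL sL sL tr"
    and tr_skew: "tr x y z = - tr y x z"
    and LY1: "br (br x y) z + br (br y z) x + br (br z x) y
              + tr x y z + tr z x y + tr y z x = 0"
    and LY2: "tr (br x y) z a + tr (br y z) x a + tr (br z x) y a = 0"
    and LY3: "tr a b (br x y) = br (tr a b x) y + br x (tr a b y)"
    and LY4: "tr a b (tr x y z) = tr (tr a b x) y z + tr x (tr a b y) z + tr x y (tr a b z)"

definition rep_D ::
  "('l \<Rightarrow> 'l \<Rightarrow> 'l) \<Rightarrow> ('l \<Rightarrow> 'v \<Rightarrow> 'v) \<Rightarrow> ('l \<Rightarrow> 'l \<Rightarrow> 'v \<Rightarrow> 'v) \<Rightarrow>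
   'l \<Rightarrow> 'l \<Rightarrow> 'v \<Rightarrow> 'v::ab_group_add" where
  "rep_D br rho theta x y u =
     theta y x u - theta x y u - rho (br x y) u + rho x (rho y u) - rho y (rho x u)"

locale ly_representation =
  lie_yamaguti_algebra sL br tr + V: vector_space sV
  for sL :: "'k::field \<Rightarrow> 'l::ab_group_add \<Rightarrow> 'l" and br tr
    and sV :: "'k \<Rightarrow> 'v::ab_group_add \<Rightarrow> 'v" +
  fixes rho :: "'l \<Rightarrow> 'v \<Rightarrow> 'v" and theta :: "'l \<Rightarrow> 'l \<Rightarrow> 'v \<Rightarrow> 'v"
  assumes rho_bilinear: "bilinear_map sL sV sV rho"
    and theta_trilinear: "trilinear_map sL sL sV sV theta"
    and rep1: "theta (br x y) z u - theta x z (rho y u) + theta y z (rho x u) = 0"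
    and rep2: "rep_D br rho theta x y (rho z u) - rho z (rep_D br rho theta x y u)
               - rho (tr x y z) u = 0"
    and rep3: "theta x (br y z) u - rho y (theta x z u) + rho z (theta x y u) = 0"
    and rep4: "rep_D br rho theta a b (theta x y u) - theta x y (rep_D br rho theta a b u)
               - theta (tr a b x) y u - theta x (tr a b y) u = 0"
    and rep5: "theta a (tr x y z) u - theta y z (theta a x u) + theta x z (theta a y u)
               - rep_D br rho theta x y (theta a z u) = 0"
begin

abbreviation D :: "'l \<Rightarrow> 'l \<Rightarrow> 'v \<Rightarrow> 'v" where
  "D \<equiv> rep_D br rho theta"

end

locale ly_cocycle =
  ly_representation sL br tr sV rho theta
  for sL :: "'k::field \<Rightarrow> 'l::ab_group_add \<Rightarrow> 'l" and br tr
    and sV :: "'k \<Rightarrow> 'v::ab_group_add \<Rightarrow> 'v" and rho theta +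
  fixes G1 :: "'l \<Rightarrow> 'l \<Rightarrow> 'v" and G2 :: "'l \<Rightarrow> 'l \<Rightarrow> 'l \<Rightarrow> 'v"
  assumes G1_bilinear: "bilinear_map sL sL sV G1"
    and G1_skew: "G1 x y = - G1 y x"
    and G2_trilinear: "trilinear_map sL sL sL sV G2"
    and G2_skew: "G2 x y z = - G2 y x z"
    and cocycle1:
      "- rho x1 (G1 y1 z) - rho y1 (G1 z x1) - rho z (G1 x1 y1)
       + G1 (br x1 y1) z + G1 (br y1 z) x1 + G1 (br z x1) y1
       + G2 x1 y1 z + G2 y1 z x1 + G2 z x1 y1 = 0"
    and cocycle2:
      "theta x1 y2 (G1 y1 x2) + theta y1 y2 (G1 x2 x1) + theta x2 y2 (G1 x1 y1)
       + G2 (br x1 y1) x2 y2 + G2 (br y1 x2) x1 y2 + G2 (br x2 x1) y1 y2 = 0"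
    and cocycle3:
      "- rho x2 (G2 x1 y1 y2) + rho y2 (G2 x1 y1 x2) + G2 x1 y1 (br x2 y2)
       + D x1 y1 (G1 x2 y2) - G1 (tr x1 y1 x2) y2 - G1 x2 (tr x1 y1 y2) = 0"
    and cocycle4:
      "- theta y2 z (G2 x1 y1 x2) + theta x2 z (G2 x1 y1 y2)
       + D x1 y1 (G2 x2 y2 z) - D x2 y2 (G2 x1 y1 z)
       - G2 (tr x1 y1 x2) y2 z - G2 x2 (tr x1 y1 y2) z
       + G2 x1 y1 (tr x2 y2 z) - G2 x2 y2 (tr x1 y1 z) = 0"


section \<open>Twisted Rota-Baxter families, their cohomology and linear deformations\<close>

text \<open>A commutative semigroup with unit \<open>\<Omega>\<close> is a type of class \<open>comm_monoid_mult\<close>.\<close>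

locale twisted_RB_family =
  ly_cocycle sL br tr sV rho theta G1 G2
  for sL :: "'k::field \<Rightarrow> 'l::ab_group_add \<Rightarrow> 'l" and br tr
    and sV :: "'k \<Rightarrow> 'v::ab_group_add \<Rightarrow> 'v" and rho theta G1 G2 +
  fixes T :: "'o::comm_monoid_mult \<Rightarrow> 'v \<Rightarrow> 'l"
  assumes T_linear: "Vector_Spaces.linear sV sL (T \<alpha>)"
    and T_br:
      "br (T \<alpha> u) (T \<beta> v) =
       T (\<alpha> * \<beta>) (rho (T \<alpha> u) v - rho (T \<beta> v) u + G1 (T \<alpha> u) (T \<beta> v))"
    and T_tr:
      "tr (T \<alpha> u) (T \<beta> v) (T \<gamma> w) =
       T (\<alpha> * \<beta> * \<gamma>) (D (T \<alpha> u) (T \<beta> v) w - theta (T \<alpha> u) (T \<gamma> w) v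
         + theta (T \<beta> v) (T \<gamma> w) u + G2 (T \<alpha> u) (T \<beta> v) (T \<gamma> w))"

text \<open>The polynomials \<open>V[t]\<close> with coefficients in a vector space \<open>V\<close> form the type \<open>'v poly\<close>, and
  \<open>pCons 0\<close> is multiplication by \<open>t\<close>. For linear maps \<open>f\<close>, \<open>g\<close> from \<open>V\<close> to \<open>W\<close> the following is
  the \<open>K[t]\<close>-linear map \<open>f + t g\<close> from \<open>V[t]\<close> to \<open>W[t]\<close>.\<close>

definition first_order ::
  "('v \<Rightarrow> 'w) \<Rightarrow> ('v \<Rightarrow> 'w) \<Rightarrow> 'v::ab_group_add poly \<Rightarrow> 'w::ab_group_add poly" where
  "first_order f g p = map_poly f p + pCons 0 (map_poly g p)"

context twisted_RB_family
begin

definition C1 :: "('o \<Rightarrow> 'v \<Rightarrow> 'l) set" where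
  "C1 = {f. \<forall>\<alpha>. Vector_Spaces.linear sV sL (f \<alpha>)}"

definition d0 :: "(('l \<times> 'l) \<Rightarrow>\<^sub>0 'k) set \<Rightarrow> 'o \<Rightarrow> 'v \<Rightarrow> 'l" where
  "d0 \<omega> \<alpha> u = wedge2_lift sL (\<lambda>a b. T \<alpha> (D a b u + G2 a b (T \<alpha> u)) - tr a b (T \<alpha> u)) \<omega>"

definition d_I :: "('o \<Rightarrow> 'v \<Rightarrow> 'l) \<Rightarrow> 'o \<Rightarrow> 'o \<Rightarrow> 'v \<Rightarrow> 'v \<Rightarrow> 'l" where
  "d_I f \<alpha> \<beta> u v =
     br (T \<alpha> u) (f \<beta> v) + T (\<alpha> * \<beta>) (rho (f \<beta> v) u + G1 (f \<beta> v) (T \<alpha> u))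
     - br (T \<beta> v) (f \<alpha> u) - T (\<alpha> * \<beta>) (rho (f \<alpha> u) v + G1 (f \<alpha> u) (T \<beta> v))
     - f (\<alpha> * \<beta>) (rho (T \<alpha> u) v - rho (T \<beta> v) u + G1 (T \<alpha> u) (T \<beta> v))"

definition d_II ::
  "('o \<Rightarrow> 'v \<Rightarrow> 'l) \<Rightarrow> 'o \<Rightarrow> 'o \<Rightarrow> 'o \<Rightarrow> 'v \<Rightarrow> 'v \<Rightarrow> 'v \<Rightarrow> 'l" where
  "d_II f \<alpha> \<beta> \<gamma> u v w =
     tr (T \<alpha> u) (T \<beta> v) (f \<gamma> w)
     - T (\<alpha> * \<beta> * \<gamma>) (theta (T \<beta> v) (f \<gamma> w) u - theta (T \<alpha> u) (f \<gamma> w) v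
         + G2 (T \<alpha> u) (T \<beta> v) (f \<gamma> w))
     + tr (f \<alpha> u) (T \<beta> v) (T \<gamma> w)
     - T (\<alpha> * \<beta> * \<gamma>) (D (f \<alpha> u) (T \<beta> v) w - theta (f \<alpha> u) (T \<gamma> w) v
         + G2 (f \<alpha> u) (T \<beta> v) (T \<gamma> w))
     - tr (f \<beta> v) (T \<alpha> u) (T \<gamma> w)
     + T (\<alpha> * \<beta> * \<gamma>) (D (f \<beta> v) (T \<alpha> u) w - theta (f \<beta> v) (T \<gamma> w) u
         + G2 (f \<beta> v) (T \<alpha> u) (T \<gamma> w))
     - f (\<alpha> * \<beta> * \<gamma>) (D (T \<alpha> u) (T \<beta> v) w + theta (T \<beta> v) (T \<gamma> w) u
         - theta (T \<alpha> u) (T \<gamma> w) v + G2 (T \<alpha> u) (T \<beta> v) (T \<gamma> w))"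

definition Z1 :: "('o \<Rightarrow> 'v \<Rightarrow> 'l) set" where
  "Z1 = {f \<in> C1. (\<forall>\<alpha> \<beta> u v. d_I f \<alpha> \<beta> u v = 0) \<and>
                 (\<forall>\<alpha> \<beta> \<gamma> u v w. d_II f \<alpha> \<beta> \<gamma> u v w = 0)}"

definition B1 :: "('o \<Rightarrow> 'v \<Rightarrow> 'l) set" where
  "B1 = d0 ` wedge2 sL"

definition cohomology_class :: "('o \<Rightarrow> 'v \<Rightarrow> 'l) \<Rightarrow> ('o \<Rightarrow> 'v \<Rightarrow> 'l) set" where
  "cohomology_class f = {\<lambda>\<alpha> u. f \<alpha> u + b \<alpha> u | b. b \<in> B1}"

definition H1 :: "('o \<Rightarrow> 'v \<Rightarrow> 'l) set set" where
  "H1 = cohomology_class ` Z1"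

text \<open>\<open>T + t T1\<close> is a linear deformation of \<open>T\<close>, with infinitesimal \<open>T1\<close>.\<close>

definition linear_deformation :: "('o \<Rightarrow> 'v \<Rightarrow> 'l) \<Rightarrow> bool" where
  "linear_deformation T1 \<longleftrightarrow> T1 \<in> C1 \<and>
     (\<forall>t. twisted_RB_family sL br tr sV rho theta G1 G2 (\<lambda>\<alpha> u. T \<alpha> u + sL t (T1 \<alpha> u)))"

text \<open>The equation is \<open>\<eta>\<^sup>t \<circ> T\<^sup>t\<^sub>\<alpha> = T'\<^sup>t\<^sub>\<alpha> \<circ> \<zeta>\<^sup>t\<^sub>\<alpha>\<close> for maps \<open>V[t] \<rightarrow> L[t]\<close>; the expressions in \<open>(a, b)\<close> are
  extended linearly to an arbitrary element \<open>\<omega>\<close> of the exterior square.\<close>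

definition eta :: "(('l \<times> 'l) \<Rightarrow>\<^sub>0 'k) set \<Rightarrow> 'l poly \<Rightarrow> 'l poly" where
  "eta \<omega> = first_order id (\<lambda>x. wedge2_lift sL (\<lambda>a b. tr a b x) \<omega>)"

definition zeta :: "(('l \<times> 'l) \<Rightarrow>\<^sub>0 'k) set \<Rightarrow> 'o \<Rightarrow> 'v poly \<Rightarrow> 'v poly" where
  "zeta \<omega> \<alpha> = first_order id (\<lambda>u. wedge2_lift sV (\<lambda>a b. D a b u + G2 a b (T \<alpha> u)) \<omega>)"

definition equivalent_deformations ::
  "('o \<Rightarrow> 'v \<Rightarrow> 'l) \<Rightarrow> ('o \<Rightarrow> 'v \<Rightarrow> 'l) \<Rightarrow> bool" where
  "equivalent_deformations T1 T1' \<longleftrightarrow>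
     (\<exists>\<omega>\<in>wedge2 sL. \<forall>\<alpha>.
        eta \<omega> \<circ> first_order (T \<alpha>) (T1 \<alpha>) = first_order (T \<alpha>) (T1' \<alpha>) \<circ> zeta \<omega> \<alpha>)"

end

end

theory Submission
  imports Defs
begin

text \<open>Substituting \<open>T + t T\<^sup>1\<close> into the identities of a twisted Rota-Baxter family gives polynomials
  in \<open>t\<close> with coefficients in \<open>L\<close>, of degree at most \<open>4\<close>, that vanish for all \<open>t\<close> in an infinite
  field. Hence their coefficients vanish, and those of \<open>t\<close> are the components of \<open>\<partial>T\<^sup>1\<close>.
  Comparing the coefficients of \<open>t\<close> in the equivalence equation on constant polynomials gives
  \<open>T\<^sup>1 - T'\<^sup>1 = \<partial>(a, b)\<close>.\<close>

section \<open>Polynomial identities over an algebraically closed field\<close>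

text \<open>Over a finite field the product of all \<open>X - a\<close>, plus 1, would have positive
  degree and take the value 1 everywhere, hence have no root.\<close>

lemma infinite_UNIV_alg_closed_field: "infinite (UNIV :: 'k::alg_closed_field set)"
proof
  assume fin: "finite (UNIV :: 'k set)"
  define q :: "'k poly" where "q = (\<Prod>a\<in>UNIV. [:- a, 1:])"
  have "degree q = card (UNIV :: 'k set)"
    unfolding q_def by (subst degree_prod_eq_sum_degree) auto
  with fin have "degree q > 0"
    by (simp add: card_gt_0_iff)
  then have "degree (q + 1) > 0"
    by (simp add: degree_add_eq_left)
  then obtain x where "poly (q + 1) x = 0"
    using alg_closed_imp_poly_has_root by blast
  moreover have "poly q x = 0"
    using fin by (auto simp: q_def poly_prod)
  ultimately show False by simp
qed

text \<open>Coordinates in a basis turn a vector-valued polynomial into scalar ones. Each of these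
  vanishes on an infinite field, so it is the zero polynomial. No finiteness of the dimension is
  involved.\<close>

lemma (in vector_space) polynomial_coeff_eq_0:
  assumes inf: "infinite (UNIV :: 'a set)"
    and zero: "\<And>t. (\<Sum>i\<le>n. scale (t ^ i) (c i)) = 0" and "i \<le> n"
  shows "c i = 0"
proof -
  define B where "B = extend_basis {}"
  have B: "independent B" "span B = UNIV"
    by (simp_all add: B_def independent_empty independent_extend_basis span_extend_basis)
  have "representation B (c i) b = 0" for b
  proof -
    define p where "p = (\<Sum>i\<le>n. monom (representation B (c i) b) i)"
    have "poly p t = representation B (\<Sum>i\<le>n. scale (t ^ i) (c i)) b" for t
      using B by (simp add: p_def poly_sum poly_monom representation_sum representation_scale mult.commute)
    then have "poly p t = 0" for t
      by (simp add: zero representation_zero)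
    then have "p = 0"
      using inf poly_roots_finite[of p] by auto
    then have "coeff p i = 0" by simp
    then show ?thesis
      using \<open>i \<le> n\<close> by (simp add: p_def coeff_sum)
  qed
  then have "(\<Sum>b | representation B (c i) b \<noteq> 0. scale (representation B (c i) b) b) = 0"
    by simp
  then show ?thesis
    using B by (simp add: sum_nonzero_representation_eq)
qed

text \<open>Degree 4 covers both Rota-Baxter identities: in the ternary one the outer operator and
  the three inner ones each contribute a factor of degree 1 in \<open>t\<close>.\<close>

lemma (in vector_space) quartic_linear_coeff_eq_0:
  assumes inf: "infinite (UNIV :: 'a set)"
    and zero: "\<And>t. e0 + scale t e1 + scale (t ^ 2) e2 + scale (t ^ 3) e3 + scale (t ^ 4) e4 = 0"
  shows "e1 = 0"
proof -
  have "(\<Sum>i\<le>4. scale (t ^ i) ([e0, e1, e2, e3, e4] ! i)) = 0" for t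
    using zero[of t] by (simp add: eval_nat_numeral)
  from polynomial_coeff_eq_0[OF inf this, of 1] show ?thesis by simp
qed

text \<open>Turns skew-symmetric maps into alternating ones, which is what
  \<open>wedge2_lift_eq\<close> asks for.\<close>

lemma char_neq_2_eq_neg_imp_eq_0:
  fixes sL :: "'k::field \<Rightarrow> 'a::ab_group_add \<Rightarrow> 'a" and x :: 'a
  assumes "vector_space sL" "CHAR('k) \<noteq> 2" "x = - x"
  shows "x = 0"
proof -
  interpret vector_space sL by fact
  have "CHAR('k) \<noteq> 1" by simp
  \<comment> \<open>The divisors of 2 are 1 and 2, and characteristic 0 divides only 0.\<close>
  then have "\<not> CHAR('k) dvd 2"
    using assms(2) dvd_imp_le[of "CHAR('k)" 2] by (cases "CHAR('k) = 0") (auto simp: le_Suc_eq numeral_2_eq_2)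
  then have "(2::'k) \<noteq> 0"
    using of_nat_eq_0_iff_char_dvd[of 2, where ?'a = 'k] by simp
  moreover have "sL 2 x = sL (1 + 1) x" by simp
  then have "sL 2 x = x + x" by (simp only: scale_left_distrib scale_one)
  then have "sL 2 x = 0"
    using \<open>x = - x\<close> by (metis add.right_inverse)
  ultimately show ?thesis by simp
qed

section \<open>Multilinearity\<close>

lemma linear_map_simps:
  assumes "Vector_Spaces.linear s1 s2 f"
  shows "f (x + y) = f x + f y" "f (s1 c x) = s2 c (f x)" "f 0 = 0" "f (- x) = - f x"
    "f (x - y) = f x - f y" "f (sum g A) = (\<Sum>i\<in>A. f (g i))"
proof -
  interpret Vector_Spaces.linear s1 s2 f by fact
  show "f (x + y) = f x + f y" "f (s1 c x) = s2 c (f x)" "f 0 = 0" "f (- x) = - f x"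
    "f (x - y) = f x - f y" "f (sum g A) = (\<Sum>i\<in>A. f (g i))"
    by (simp_all add: add scale zero neg diff sum)
qed

lemma bilinear_map_simps:
  assumes "bilinear_map sA sB sC f"
  shows "f (x + x') y = f x y + f x' y" "f (sA c x) y = sC c (f x y)"
    "f x (y + y') = f x y + f x y'" "f x (sB c y) = sC c (f x y)"
proof -
  have *: "Vector_Spaces.linear sA sC (\<lambda>x. f x y)" "Vector_Spaces.linear sB sC (f x)" for x y
    using assms by (auto simp: bilinear_map_def)
  show "f (x + x') y = f x y + f x' y" "f (sA c x) y = sC c (f x y)"
    "f x (y + y') = f x y + f x y'" "f x (sB c y) = sC c (f x y)"
    by (fact linear_map_simps[OF *(1)] linear_map_simps[OF *(2)])+
qed

lemma trilinear_map_simps: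
  assumes "trilinear_map sA sB sC sD f"
  shows "f (x + x') y z = f x y z + f x' y z" "f (sA c x) y z = sD c (f x y z)"
    "f x (y + y') z = f x y z + f x y' z" "f x (sB c y) z = sD c (f x y z)"
    "f x y (z + z') = f x y z + f x y z'" "f x y (sC c z) = sD c (f x y z)"
proof -
  have *: "Vector_Spaces.linear sA sD (\<lambda>x. f x y z)" "bilinear_map sB sC sD (f x)" for x y z
    using assms by (auto simp: trilinear_map_def)
  show "f (x + x') y z = f x y z + f x' y z" "f (sA c x) y z = sD c (f x y z)"
    "f x (y + y') z = f x y z + f x y' z" "f x (sB c y) z = sD c (f x y z)"
    "f x y (z + z') = f x y z + f x y z'" "f x y (sC c z) = sD c (f x y z)"
    by (fact linear_map_simps[OF *(1)] bilinear_map_simps[OF *(2)])+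
qed

lemma bilinear_mapI:
  assumes "vector_space sA" "vector_space sB" "vector_space sC"
    and "\<And>x x' y. f (x + x') y = f x y + f x' y" "\<And>c x y. f (sA c x) y = sC c (f x y)"
    and "\<And>x y y'. f x (y + y') = f x y + f x y'" "\<And>c x y. f x (sB c y) = sC c (f x y)"
  shows "bilinear_map sA sB sC f"
  using assms by (simp add: bilinear_map_def Vector_Spaces.linear_iff)

context ly_representation
begin

lemmas rep_multilinear_simps =
  bilinear_map_simps[OF br_bilinear] bilinear_map_simps[OF rho_bilinear]
  trilinear_map_simps[OF tr_trilinear] trilinear_map_simps[OF theta_trilinear]

lemma D_multilinear_simps:
  "D (x + x') y u = D x y u + D x' y u" "D (sL c x) y u = sV c (D x y u)"
  "D x (y + y') u = D x y u + D x y' u" "D x (sL c y) u = sV c (D x y u)"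
  "D x y (u + u') = D x y u + D x y u'" "D x y (sV c u) = sV c (D x y u)"
  by (simp_all add: rep_D_def rep_multilinear_simps V.scale_right_distrib V.scale_right_diff_distrib)

text \<open>The \<open>theta\<close> terms and the commutator of \<open>rho\<close> change sign
  visibly; the remaining term needs skew-symmetry of \<open>br\<close>.\<close>

lemma D_skew: "D x y u = - D y x u"
proof -
  interpret rho: Vector_Spaces.linear sL sV "\<lambda>x. rho x u"
    using rho_bilinear by (simp add: bilinear_map_def)
  have "rho (br x y) u = - rho (br y x) u"
    by (subst br_skew) (rule rho.neg)
  then show ?thesis by (simp add: rep_D_def)
qed

end

context ly_cocycle
begin

lemmas multilinear_simps = rep_multilinear_simps D_multilinear_simps
  bilinear_map_simps[OF G1_bilinear] trilinear_map_simps[OF G2_trilinear]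

end

section \<open>The exterior square\<close>

text \<open>This and the next two lemmas pass between cosets in \<open>wedge2\<close> and
  representatives in the free space.\<close>

lemma wedge2_class: "{\<xi>'. \<xi>' - \<xi> \<in> wedge2_relations sL} \<in> wedge2 sL"
  unfolding wedge2_def quotient_def by auto

lemma wedge2_class_self: "\<xi> \<in> {\<xi>'. \<xi>' - \<xi> \<in> wedge2_relations sL}"
proof -
  interpret F: vector_space free_scale by (rule vector_space_free_scale)
  show ?thesis by (simp add: wedge2_relations_def F.span_zero)
qed

lemma wedge2_nonempty:
  assumes "\<omega> \<in> wedge2 sL"
  obtains \<xi> where "\<xi> \<in> \<omega>"
  using assms wedge2_class_self unfolding wedge2_def quotient_def by blast

section \<open>Deformations and cohomology\<close>

context twisted_RB_family
begin

lemmas T_simps = linear_map_simps[OF T_linear]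

section \<open>Infinitesimals are cocycles\<close>

lemma linear_deformation_imp_d_I_eq_0:
  assumes inf: "infinite (UNIV :: 'k set)" and def: "linear_deformation f"
  shows "d_I f \<alpha> \<beta> u v = 0"
proof -
  have "Vector_Spaces.linear sV sL (f \<alpha>)" for \<alpha>
    using def by (simp add: linear_deformation_def C1_def)
  note f_simps = linear_map_simps[OF this]
  \<comment> \<open>Unprimed letters denote values of \<open>T\<close>, primed ones the
    corresponding values of \<open>f\<close>; \<open>S\<close> and \<open>g\<close> are the outer
    operators.\<close>
  define S where "S = T (\<alpha> * \<beta>)"
  define g where "g = f (\<alpha> * \<beta>)"
  define a where "a = T \<alpha> u"
  define a' where "a' = f \<alpha> u"
  define b where "b = T \<beta> v"
  define b' where "b' = f \<beta> v"
  note defs = S_def g_def a_def a'_def b_def b'_def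
  \<comment> \<open>\<open>w0\<close>, \<open>w1\<close>, \<open>w2\<close> are the coefficients of
    1, \<open>t\<close>, \<open>t^2\<close> in the argument of the outer operator
    \<open>S + t g\<close>. Thus \<open>w1\<close> meets \<open>S\<close> and \<open>w0\<close>
    meets \<open>g\<close> in the coefficient of \<open>t\<close>.\<close>
  define w0 where "w0 = rho a v - rho b u + G1 a b"
  define w1 where "w1 = rho a' v - rho b' u + G1 a' b + G1 a b'"
  define w2 where "w2 = G1 a' b'"
  have "(br a b - S w0) + sL t (br a' b + br a b' - S w1 - g w0)
    + sL (t ^ 2) (br a' b' - S w2 - g w1) + sL (t ^ 3) (- g w2) + sL (t ^ 4) 0 = 0" for t
  proof -
    have "twisted_RB_family sL br tr sV rho theta G1 G2 (\<lambda>\<alpha> u. T \<alpha> u + sL t (f \<alpha> u))"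
      using def by (simp add: linear_deformation_def)
    from twisted_RB_family.T_br[OF this, of \<alpha> u \<beta> v]
    \<comment> \<open>Leaving the argument as a free \<open>W\<close> lets its expansion in powers
      of \<open>t\<close> be substituted before the linear maps \<open>S\<close> and
      \<open>g\<close> are applied.\<close>
    have eq: "br (a + sL t a') (b + sL t b') = S W + sL t (g W)"
      if "W = rho (a + sL t a') v - rho (b + sL t b') u + G1 (a + sL t a') (b + sL t b')" for W
      by (simp add: defs that)
    have "w0 + sV t w1 + sV (t ^ 2) w2
      = rho (a + sL t a') v - rho (b + sL t b') u + G1 (a + sL t a') (b + sL t b')"
      by (simp add: w0_def w1_def w2_def multilinear_simps V.scale_right_distrib
          V.scale_right_diff_distrib power2_eq_square)
    from eq[OF this] show ?thesis
      by (simp add: multilinear_simps T_simps f_simps S_def g_def L.scale_right_distrib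
          L.scale_right_diff_distrib power2_eq_square power3_eq_cube algebra_simps)
  qed
  from L.quartic_linear_coeff_eq_0[OF inf this]
  have "br a' b + br a b' - S w1 - g w0 = 0" .
  \<comment> \<open>These swaps reconcile the expanded coefficient with the order of arguments in
    \<open>d_I\<close>.\<close>
  moreover have "br b a' = - br a' b" "G1 b' a = - G1 a b'"
    by (rule br_skew G1_skew)+
  ultimately show ?thesis
    unfolding d_I_def defs[symmetric]
    by (simp add: w0_def w1_def S_def T_simps algebra_simps)
qed

lemma linear_deformation_imp_d_II_eq_0:
  assumes inf: "infinite (UNIV :: 'k set)" and def: "linear_deformation f"
  shows "d_II f \<alpha> \<beta> \<gamma> u v w = 0"
proof -
  have "Vector_Spaces.linear sV sL (f \<alpha>)" for \<alpha>
    using def by (simp add: linear_deformation_def C1_def)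
  note f_simps = linear_map_simps[OF this]
  define S where "S = T (\<alpha> * \<beta> * \<gamma>)"
  define g where "g = f (\<alpha> * \<beta> * \<gamma>)"
  define a where "a = T \<alpha> u"
  define a' where "a' = f \<alpha> u"
  define b where "b = T \<beta> v"
  define b' where "b' = f \<beta> v"
  define c where "c = T \<gamma> w"
  define c' where "c' = f \<gamma> w"
  note defs = S_def g_def a_def a'_def b_def b'_def c_def c'_def
  \<comment> \<open>Again the \<open>w\<close> are the coefficients of the outer argument, now up to
    \<open>t^3\<close>; \<open>w1\<close> collects the terms with exactly one primed entry.\<close>
  define w0 where "w0 = D a b w - theta a c v + theta b c u + G2 a b c"
  define w1 where "w1 = D a' b w + D a b' w - theta a' c v - theta a c' v
    + theta b' c u + theta b c' u + G2 a' b c + G2 a b' c + G2 a b c'"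
  define w2 where "w2 = D a' b' w - theta a' c' v + theta b' c' u
    + G2 a' b' c + G2 a' b c' + G2 a b' c'"
  define w3 where "w3 = G2 a' b' c'"
  have "(tr a b c - S w0) + sL t (tr a' b c + tr a b' c + tr a b c' - S w1 - g w0)
    + sL (t ^ 2) (tr a' b' c + tr a' b c' + tr a b' c' - S w2 - g w1)
    + sL (t ^ 3) (tr a' b' c' - S w3 - g w2) + sL (t ^ 4) (- g w3) = 0" for t
  proof -
    define W where "W = w0 + sV t w1 + sV (t ^ 2) w2 + sV (t ^ 3) w3"
    have "twisted_RB_family sL br tr sV rho theta G1 G2 (\<lambda>\<alpha> u. T \<alpha> u + sL t (f \<alpha> u))"
      using def by (simp add: linear_deformation_def)
    from twisted_RB_family.T_tr[OF this, of \<alpha> u \<beta> v \<gamma> w]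
    have eq: "tr (a + sL t a') (b + sL t b') (c + sL t c') = S W + sL t (g W)"
      if "W = D (a + sL t a') (b + sL t b') w - theta (a + sL t a') (c + sL t c') v
        + theta (b + sL t b') (c + sL t c') u
        + G2 (a + sL t a') (b + sL t b') (c + sL t c')"
      by (simp add: defs that)
    have "W = D (a + sL t a') (b + sL t b') w - theta (a + sL t a') (c + sL t c') v
        + theta (b + sL t b') (c + sL t c') u
        + G2 (a + sL t a') (b + sL t b') (c + sL t c')"
      by (simp add: W_def w0_def w1_def w2_def w3_def multilinear_simps V.scale_right_distrib
          V.scale_right_diff_distrib power2_eq_square power3_eq_cube algebra_simps)
    note eq[OF this]
    moreover have "S W = S w0 + sL t (S w1) + sL (t ^ 2) (S w2) + sL (t ^ 3) (S w3)"
      "g W = g w0 + sL t (g w1) + sL (t ^ 2) (g w2) + sL (t ^ 3) (g w3)"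
      by (simp_all add: W_def S_def g_def T_simps f_simps)
    ultimately show ?thesis
      by (simp add: multilinear_simps L.scale_right_distrib L.scale_right_diff_distrib
          power2_eq_square power3_eq_cube power4_eq_xxxx algebra_simps)
  qed
  from L.quartic_linear_coeff_eq_0[OF inf this]
  have "tr a' b c + tr a b' c + tr a b c' - S w1 - g w0 = 0" .
  \<comment> \<open>In \<open>d_II\<close> the terms with \<open>f \<beta> v\<close> carry it in the
    first slot, whereas the expansion leaves it in the second.\<close>
  moreover have "tr b' a c = - tr a b' c" "G2 b' a c = - G2 a b' c" "D b' a w = - D a b' w"
    by (rule tr_skew G2_skew D_skew)+
  ultimately show ?thesis
    unfolding d_II_def defs[symmetric]
    by (simp add: w0_def w1_def S_def T_simps algebra_simps)
qed

lemma linear_deformation_imp_Z1: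
  assumes "infinite (UNIV :: 'k set)" "linear_deformation f"
  shows "f \<in> Z1"
  using assms linear_deformation_imp_d_I_eq_0 linear_deformation_imp_d_II_eq_0
  by (simp add: Z1_def linear_deformation_def)

section \<open>Induced maps computed on representatives\<close>

lemma wedge2_lift_zeta:
  assumes "CHAR('k) \<noteq> 2" "\<omega> \<in> wedge2 sL" "\<xi> \<in> \<omega>"
  shows "wedge2_lift sV (\<lambda>a b. D a b u + G2 a b (T \<alpha> u)) \<omega>
    = free_lift sV (\<lambda>a b. D a b u + G2 a b (T \<alpha> u)) \<xi>"
proof (rule wedge2_lift_eq[OF _ _ assms(2,3)])
  show "bilinear_map sL sL sV (\<lambda>a b. D a b u + G2 a b (T \<alpha> u))"
    by (rule bilinear_mapI, simp_all add: algebra_simps multilinear_simps V.scale_right_distrib L.vector_space_axioms V.vector_space_axioms)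
  show "D a a u + G2 a a (T \<alpha> u) = 0" for a
    using char_neq_2_eq_neg_imp_eq_0[OF V.vector_space_axioms assms(1) D_skew]
      char_neq_2_eq_neg_imp_eq_0[OF V.vector_space_axioms assms(1) G2_skew] by simp
qed

lemma wedge2_lift_eta:
  assumes "CHAR('k) \<noteq> 2" "\<omega> \<in> wedge2 sL" "\<xi> \<in> \<omega>"
  shows "wedge2_lift sL (\<lambda>a b. tr a b x) \<omega> = free_lift sL (\<lambda>a b. tr a b x) \<xi>"
proof (rule wedge2_lift_eq[OF _ _ assms(2,3)])
  show "bilinear_map sL sL sL (\<lambda>a b. tr a b x)"
    by (rule bilinear_mapI) (simp_all add: multilinear_simps L.vector_space_axioms)
  show "tr a a x = 0" for a
    by (rule char_neq_2_eq_neg_imp_eq_0[OF L.vector_space_axioms assms(1) tr_skew])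
qed

lemma d0_eq_free_lift:
  assumes "CHAR('k) \<noteq> 2" "\<omega> \<in> wedge2 sL" "\<xi> \<in> \<omega>"
  shows "d0 \<omega> \<alpha> u = free_lift sL (\<lambda>a b. T \<alpha> (D a b u + G2 a b (T \<alpha> u)) - tr a b (T \<alpha> u)) \<xi>"
  unfolding d0_def
proof (rule wedge2_lift_eq[OF _ _ assms(2,3)])
  show "bilinear_map sL sL sL (\<lambda>a b. T \<alpha> (D a b u + G2 a b (T \<alpha> u)) - tr a b (T \<alpha> u))"
    by (rule bilinear_mapI, simp_all add: algebra_simps multilinear_simps T_simps L.scale_right_distrib L.scale_right_diff_distrib
        L.vector_space_axioms)
  show "T \<alpha> (D a a u + G2 a a (T \<alpha> u)) - tr a a (T \<alpha> u) = 0" for a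
  proof -
    have "D a a u = 0" "G2 a a (T \<alpha> u) = 0" "tr a a (T \<alpha> u) = 0"
      by (rule char_neq_2_eq_neg_imp_eq_0[OF V.vector_space_axioms assms(1) D_skew]
          char_neq_2_eq_neg_imp_eq_0[OF V.vector_space_axioms assms(1) G2_skew]
          char_neq_2_eq_neg_imp_eq_0[OF L.vector_space_axioms assms(1) tr_skew])+
    then show ?thesis by (simp add: T_simps)
  qed
qed

text \<open>Since \<open>T \<alpha>\<close> is linear, it commutes with the finite sum in
  \<open>free_lift\<close>. This splits the single lift defining \<open>d0\<close> into the two
  lifts that occur in \<open>zeta\<close> and \<open>eta\<close>.\<close>

lemma d0_eq:
  assumes "CHAR('k) \<noteq> 2" "\<omega> \<in> wedge2 sL"
  shows "d0 \<omega> \<alpha> u = T \<alpha> (wedge2_lift sV (\<lambda>a b. D a b u + G2 a b (T \<alpha> u)) \<omega>)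
    - wedge2_lift sL (\<lambda>a b. tr a b (T \<alpha> u)) \<omega>"
proof -
  obtain \<xi> where \<xi>: "\<xi> \<in> \<omega>" using assms(2) by (rule wedge2_nonempty)
  show ?thesis
    unfolding d0_eq_free_lift[OF assms \<xi>] wedge2_lift_zeta[OF assms \<xi>] wedge2_lift_eta[OF assms \<xi>]
    by (simp add: free_lift_def T_simps L.scale_right_diff_distrib sum_subtractf)
qed

section \<open>Coboundaries and cohomology classes\<close>

text \<open>Every element of the free space represents a class, so coboundaries can be parametrized
  linearly by the free space. Closure under sums and differences then follows without a vector space
  structure on the set of cosets.\<close>

lemma B1_eq:
  assumes "CHAR('k) \<noteq> 2"
  shows "B1 = range (\<lambda>\<xi> \<alpha> u. free_lift sL
    (\<lambda>a b. T \<alpha> (D a b u + G2 a b (T \<alpha> u)) - tr a b (T \<alpha> u)) \<xi>)" (is "_ = range ?F")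
proof (intro equalityI subsetI)
  fix b assume "b \<in> B1"
  then obtain \<omega> where \<omega>: "\<omega> \<in> wedge2 sL" "b = d0 \<omega>" by (auto simp: B1_def)
  obtain \<xi> where "\<xi> \<in> \<omega>" using \<omega>(1) by (rule wedge2_nonempty)
  then have "b = ?F \<xi>" using d0_eq_free_lift[OF assms \<omega>(1)] \<omega>(2) by blast
  then show "b \<in> range ?F" by blast
next
  fix b assume "b \<in> range ?F"
  then obtain \<xi> where b: "b = ?F \<xi>" by blast
  have "?F \<xi> = d0 {\<xi>'. \<xi>' - \<xi> \<in> wedge2_relations sL}"
    by (intro ext d0_eq_free_lift[symmetric] assms wedge2_class wedge2_class_self)
  then show "b \<in> B1"
    unfolding B1_def b by (rule image_eqI[OF _ wedge2_class])
qed

lemma B1_closed: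
  assumes "CHAR('k) \<noteq> 2" "b \<in> B1" "b' \<in> B1"
  shows "(\<lambda>\<alpha> u. b \<alpha> u + b' \<alpha> u) \<in> B1" "(\<lambda>\<alpha> u. b \<alpha> u - b' \<alpha> u) \<in> B1"
proof -
  note lin = linear_map_simps[OF linear_free_lift[OF L.vector_space_axioms]]
  show "(\<lambda>\<alpha> u. b \<alpha> u + b' \<alpha> u) \<in> B1"
    using assms(2,3) unfolding B1_eq[OF assms(1)] by (auto simp flip: lin(1))
  show "(\<lambda>\<alpha> u. b \<alpha> u - b' \<alpha> u) \<in> B1"
    using assms(2,3) unfolding B1_eq[OF assms(1)] by (auto simp flip: lin(5))
qed

text \<open>The two inclusions shift the coboundary by \<open>b\<close> in opposite directions,
  hence use closure of \<open>B1\<close> under sums and differences respectively.\<close>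

lemma cohomology_class_eqI:
  assumes "CHAR('k) \<noteq> 2" "b \<in> B1" "\<And>\<alpha> u. f \<alpha> u = g \<alpha> u + b \<alpha> u"
  shows "cohomology_class f = cohomology_class g"
proof (intro equalityI subsetI)
  fix h assume "h \<in> cohomology_class f"
  then obtain c where c: "c \<in> B1" "h = (\<lambda>\<alpha> u. f \<alpha> u + c \<alpha> u)"
    by (auto simp: cohomology_class_def)
  have "h = (\<lambda>\<alpha> u. g \<alpha> u + (b \<alpha> u + c \<alpha> u))"
    by (simp add: c(2) assms(3) add.assoc)
  then show "h \<in> cohomology_class g"
    using B1_closed(1)[OF assms(1,2) c(1)]
    unfolding cohomology_class_def mem_Collect_eq
    by (intro exI[of _ "\<lambda>\<alpha> u. b \<alpha> u + c \<alpha> u"] conjI)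
next
  fix h assume "h \<in> cohomology_class g"
  then obtain c where c: "c \<in> B1" "h = (\<lambda>\<alpha> u. g \<alpha> u + c \<alpha> u)"
    by (auto simp: cohomology_class_def)
  have "h = (\<lambda>\<alpha> u. f \<alpha> u + (c \<alpha> u - b \<alpha> u))"
    by (simp add: c(2) assms(3))
  then show "h \<in> cohomology_class f"
    using B1_closed(2)[OF assms(1) c(1) assms(2)]
    unfolding cohomology_class_def mem_Collect_eq
    by (intro exI[of _ "\<lambda>\<alpha> u. c \<alpha> u - b \<alpha> u"] conjI)
qed

section \<open>Equivalent deformations\<close>

text \<open>The class \<omega> that realizes the equivalence also yields the coboundary:
  \<open>b\<close> is \<open>d0 \<omega>\<close>.\<close>

lemma equivalent_deformations_imp_cohomologous:
  assumes char: "CHAR('k) \<noteq> 2" and "f \<in> C1" "g \<in> C1" and equiv: "equivalent_deformations f g"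
  obtains b where "b \<in> B1" "\<And>\<alpha> u. f \<alpha> u = g \<alpha> u + b \<alpha> u"
proof -
  obtain \<omega> where \<omega>: "\<omega> \<in> wedge2 sL"
    and eq: "eta \<omega> \<circ> first_order (T \<alpha>) (f \<alpha>) = first_order (T \<alpha>) (g \<alpha>) \<circ> zeta \<omega> \<alpha>" for \<alpha>
    using equiv by (auto simp: equivalent_deformations_def)
  \<comment> \<open>\<open>coeff_map_poly\<close> applies only to maps fixing 0, so this is
    collected for every map inside \<open>first_order\<close>.\<close>
  have zeros: "f \<alpha> 0 = 0" "g \<alpha> 0 = 0" for \<alpha>
    using assms(2,3) unfolding C1_def by (blast intro: linear_map_simps(3))+
  obtain \<xi> where \<xi>: "\<xi> \<in> \<omega>" using \<omega> by (rule wedge2_nonempty)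
  have tr0: "tr a b 0 = 0" for a b
    using trilinear_map_simps(6)[OF tr_trilinear, of a b 0 0] by simp
  have D0: "D a b 0 = 0" for a b
    using D_multilinear_simps(6)[of a b 0 0] by simp
  have G20: "G2 a b 0 = 0" for a b
    using trilinear_map_simps(6)[OF G2_trilinear, of a b 0 0] by simp
  have lift0: "wedge2_lift sL (\<lambda>a b. tr a b 0) \<omega> = 0"
    "wedge2_lift sV (\<lambda>a b. D a b 0 + G2 a b 0) \<omega> = 0"
    unfolding wedge2_lift_zeta[OF char \<omega> \<xi>, of 0, unfolded T_simps(3)] wedge2_lift_eta[OF char \<omega> \<xi>]
    by (simp_all add: free_lift_def tr0 D0 G20 T_simps)
  have "f \<alpha> u = g \<alpha> u + d0 \<omega> \<alpha> u" for \<alpha> u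
  proof -
    \<comment> \<open>On a constant polynomial, the coefficient of \<open>t\<close> sees each
      first-order term once, next to the identity or \<open>T \<alpha>\<close>.\<close>
    have "coeff (eta \<omega> (first_order (T \<alpha>) (f \<alpha>) [:u:])) 1
      = coeff (first_order (T \<alpha>) (g \<alpha>) (zeta \<omega> \<alpha> [:u:])) 1"
      using fun_cong[OF eq, of \<alpha> "[:u:]"] by simp
    then have "f \<alpha> u + wedge2_lift sL (\<lambda>a b. tr a b (T \<alpha> u)) \<omega>
      = T \<alpha> (wedge2_lift sV (\<lambda>a b. D a b u + G2 a b (T \<alpha> u)) \<omega>) + g \<alpha> u"
      by (simp add: eta_def zeta_def first_order_def coeff_map_poly zeros lift0 T_simps(3))
    then show ?thesis
      by (simp add: d0_eq[OF char \<omega>] algebra_simps)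
  qed
  moreover have "d0 \<omega> \<in> B1" using \<omega> by (simp add: B1_def)
  ultimately show ?thesis using that by blast
qed

end

theorem theorem6p6:
  fixes sL :: "'k::alg_closed_field \<Rightarrow> 'l::ab_group_add \<Rightarrow> 'l"
    and br :: "'l \<Rightarrow> 'l \<Rightarrow> 'l" and tr :: "'l \<Rightarrow> 'l \<Rightarrow> 'l \<Rightarrow> 'l"
    and sV :: "'k \<Rightarrow> 'v::ab_group_add \<Rightarrow> 'v"
    and rho :: "'l \<Rightarrow> 'v \<Rightarrow> 'v" and theta :: "'l \<Rightarrow> 'l \<Rightarrow> 'v \<Rightarrow> 'v"
    and G1 :: "'l \<Rightarrow> 'l \<Rightarrow> 'v" and G2 :: "'l \<Rightarrow> 'l \<Rightarrow> 'l \<Rightarrow> 'v"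
    and T T1 T1' :: "'o::comm_monoid_mult \<Rightarrow> 'v \<Rightarrow> 'l"
  assumes char_not_2: "CHAR('k) \<noteq> 2" and char_not_3: "CHAR('k) \<noteq> 3"
    and L: "lie_yamaguti_algebra sL br tr"
    and V: "ly_representation sL br tr sV rho theta"
    and G: "ly_cocycle sL br tr sV rho theta G1 G2"
    and T: "twisted_RB_family sL br tr sV rho theta G1 G2 T"
    and T1: "twisted_RB_family.linear_deformation sL br tr sV rho theta G1 G2 T T1"
    and T1': "twisted_RB_family.linear_deformation sL br tr sV rho theta G1 G2 T T1'"
    and equiv: "twisted_RB_family.equivalent_deformations sL br tr sV rho theta G2 T T1 T1'"
  shows "T1 \<in> twisted_RB_family.Z1 sL br tr sV rho theta G1 G2 T \<and>
         T1' \<in> twisted_RB_family.Z1 sL br tr sV rho theta G1 G2 T \<and>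
         twisted_RB_family.cohomology_class sL br tr rho theta G2 T T1
           \<in> twisted_RB_family.H1 sL br tr sV rho theta G1 G2 T \<and>
         twisted_RB_family.cohomology_class sL br tr rho theta G2 T T1
           = twisted_RB_family.cohomology_class sL br tr rho theta G2 T T1'"
proof -
  interpret twisted_RB_family sL br tr sV rho theta G1 G2 T by (rule T)
  note inf = infinite_UNIV_alg_closed_field[where ?'k = 'k]
  have Z: "T1 \<in> Z1" "T1' \<in> Z1"
    by (rule linear_deformation_imp_Z1[OF inf T1] linear_deformation_imp_Z1[OF inf T1'])+
  then have "T1 \<in> C1" "T1' \<in> C1" by (simp_all add: Z1_def)
  then obtain b where "b \<in> B1" "\<And>\<alpha> u. T1 \<alpha> u = T1' \<alpha> u + b \<alpha> u"
    using equivalent_deformations_imp_cohomologous[OF char_not_2 _ _ equiv] by blast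
  then have "cohomology_class T1 = cohomology_class T1'"
    by (rule cohomology_class_eqI[OF char_not_2])
  with Z show ?thesis by (simp add: H1_def)
qed

end
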